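(* Let $F = GF(2^n)$ with $n \geq 2$ and let $\vartheta$ be the Frobenius automorphism of $F$, i.e. $\vartheta(x) = x^2$ for all $x \in F$. If $G$ denotes the group \[ \left\lbrace U(a, b) = \begin{bmatrix} 1 & 0 & 0\\ a & 1 & 0\\ b & \vartheta(a) & 1 \end{bmatrix} : a, b \in F \right\rbrace \] under matrix multiplication, given by $U(a, b)U(a', b') = U(a + a', b + b' + a'\vartheta(a))$, then \[ E(\Gamma_G) = LE(\Gamma_G) = LE^+(\Gamma_G) = 2(2^n - 1)^2. \]
   Context: For a finite non-abelian group $G$ with center $Z(G)$, the commuting graph $\Gamma_G$ is the simple undirected graph with vertex set $G \setminus Z(G)$ in which two distinct vertices $x, y$ are adjacent iff $xy = yx$. For a finite graph $\mathcal{G}$ with vertex set $v(\mathcal{G})$, edge set $e(\mathcal{G})$, adjacency matrix $A$ and (diagonal) degree matrix $D$, put $L = D - A$ and $Q = D + A$. With all sums over eigenvalues counted with multiplicity: the energy is $E(\mathcal{G}) = \sum |\lambda|$ over eigenvalues $\lambda$ of $A$; the Laplacian energy is $LE(\mathcal{G}) = \sum \left|\mu - \frac{2|e(\mathcal{G})|}{|v(\mathcal{G})|}\right|$ over eigenvalues $\mu$ of $L$; the signless Laplacian energy is $LE^+(\mathcal{G}) = \sum \left|\nu - \frac{2|e(\mathcal{G})|}{|v(\mathcal{G})|}\right|$ over eigenvalues $\nu$ of $Q$. *)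

theory Defs
  imports "Jordan_Normal_Form.Char_Poly" "HOL-Algebra.Group" "HOL-Number_Theory.Residues" "HOL-Library.Cardinality"
begin

record 'v ugraph =
  verts :: "'v set"
  edges :: "'v set set"

definition group_center :: "('g, 'm) monoid_scheme \<Rightarrow> 'g set" where
  "group_center G = {z \<in> carrier G. \<forall>x \<in> carrier G. z \<otimes>\<^bsub>G\<^esub> x = x \<otimes>\<^bsub>G\<^esub> z}"

definition commuting_graph :: "('g, 'm) monoid_scheme \<Rightarrow> 'g ugraph" where
  "commuting_graph G =
    \<lparr> verts = carrier G - group_center G,
      edges = {{x, y} | x y. x \<in> carrier G - group_center G \<and> y \<in> carrier G - group_center G
                 \<and> x \<noteq> y \<and> x \<otimes>\<^bsub>G\<^esub> y = y \<otimes>\<^bsub>G\<^esub> x} \<rparr>"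

definition degree_of :: "'v ugraph \<Rightarrow> 'v \<Rightarrow> nat" where
  "degree_of g v = card {e \<in> edges g. v \<in> e}"

text \<open>Matrices are indexed by natural numbers, so a matrix indexed by vertices depends on an
  enumeration of the vertices. Its characteristic polynomial does not: see
  \<open>char_poly_mat_of_list_unique\<close> below.\<close>

definition vertex_list :: "'v ugraph \<Rightarrow> 'v list" where
  "vertex_list g = (SOME vs. distinct vs \<and> set vs = verts g)"

definition mat_of_list :: "'v list \<Rightarrow> ('v \<Rightarrow> 'v \<Rightarrow> 'a) \<Rightarrow> 'a mat" where
  "mat_of_list vs m = mat (length vs) (length vs) (\<lambda>(i, j). m (vs ! i) (vs ! j))"

definition adjacency_mat :: "'v ugraph \<Rightarrow> complex mat" where
  "adjacency_mat g = mat_of_list (vertex_list g) (\<lambda>u v. if {u, v} \<in> edges g then 1 else 0)"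

definition degree_mat :: "'v ugraph \<Rightarrow> complex mat" where
  "degree_mat g = mat_of_list (vertex_list g) (\<lambda>u v. if u = v then of_nat (degree_of g u) else 0)"

definition laplacian_mat :: "'v ugraph \<Rightarrow> complex mat" where
  "laplacian_mat g = degree_mat g - adjacency_mat g"

definition signless_laplacian_mat :: "'v ugraph \<Rightarrow> complex mat" where
  "signless_laplacian_mat g = degree_mat g + adjacency_mat g"

text \<open>The eigenvalues with (algebraic) multiplicity; working over the complex numbers, none is lost.\<close>

definition eigenvalue_mset :: "complex mat \<Rightarrow> complex multiset" where
  "eigenvalue_mset A = proots (char_poly A)"

definition mean_degree :: "'v ugraph \<Rightarrow> real" where
  "mean_degree g = 2 * real (card (edges g)) / real (card (verts g))"

definition energy :: "'v ugraph \<Rightarrow> real" where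
  "energy g = (\<Sum>\<alpha> \<in># eigenvalue_mset (adjacency_mat g). cmod \<alpha>)"

definition laplacian_energy :: "'v ugraph \<Rightarrow> real" where
  "laplacian_energy g =
    (\<Sum>\<mu> \<in># eigenvalue_mset (laplacian_mat g). cmod (\<mu> - complex_of_real (mean_degree g)))"

definition signless_laplacian_energy :: "'v ugraph \<Rightarrow> real" where
  "signless_laplacian_energy g =
    (\<Sum>\<nu> \<in># eigenvalue_mset (signless_laplacian_mat g). cmod (\<nu> - complex_of_real (mean_degree g)))"

definition frobenius :: "'f :: field \<Rightarrow> 'f" where
  "frobenius x = x ^ 2"

definition U :: "'f :: field \<Rightarrow> 'f \<Rightarrow> 'f mat" where
  "U a b = mat_of_rows_list 3
    [[1, 0, 0],
     [a, 1, 0],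
     [b, frobenius a, 1]]"

definition U_group :: "'f :: field itself \<Rightarrow> 'f mat monoid" where
  "U_group _ = \<lparr> carrier = {U a b | a b. True}, mult = (*), one = 1\<^sub>m 3 \<rparr>"


lemma vertex_list:
  assumes "finite (verts g)"
  shows "distinct (vertex_list g)" "set (vertex_list g) = verts g"
proof -
  have "\<exists>vs. distinct vs \<and> set vs = verts g"
    using finite_distinct_list[OF assms] by blast
  then have "distinct (vertex_list g) \<and> set (vertex_list g) = verts g"
    unfolding vertex_list_def by (rule someI_ex)
  then show "distinct (vertex_list g)" "set (vertex_list g) = verts g" by auto
qed

lemma det_permute_both:
  fixes A :: "'a :: comm_ring_1 mat"
  assumes A: "A \<in> carrier_mat n n" and p: "p permutes {0..<n}"
  shows "det (mat n n (\<lambda>(i, j). A $$ (p i, p j))) = det A"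
proof -
  have lt: "p i < n" if "i < n" for i using permutes_in_image[OF p, of i] that by auto
  let ?B = "mat n n (\<lambda>(i, j). A $$ (p i, j))"
  let ?C = "mat n n (\<lambda>(i, j). A $$ (p i, p j))"
  have "?C = transpose_mat (mat n n (\<lambda>(i, j). transpose_mat ?B $$ (p i, j)))"
    using lt by (intro eq_matI) auto
  then have "det ?C = det (mat n n (\<lambda>(i, j). transpose_mat ?B $$ (p i, j)))"
    using det_transpose[of "mat n n (\<lambda>(i, j). transpose_mat ?B $$ (p i, j))" n] by simp
  also have "\<dots> = signof p * det (transpose_mat ?B)"
    by (rule det_permute_rows[OF _ p]) auto
  also have "det (transpose_mat ?B) = det ?B" by (rule det_transpose) auto
  also have "det ?B = signof p * det A" by (rule det_permute_rows[OF A p])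
  also have "signof p * (signof p * det A) = det A"
    by (cases "evenperm p") (simp_all add: sign_def)
  finally show ?thesis .
qed

lemma char_poly_mat_of_list_unique:
  fixes m :: "'v \<Rightarrow> 'v \<Rightarrow> 'a :: comm_ring_1"
  assumes "distinct vs" "distinct ws" "set vs = set ws"
  shows "char_poly (mat_of_list vs m) = char_poly (mat_of_list ws m)"
proof -
  define n where "n = length ws"
  have len: "length vs = n" using assms distinct_card n_def by metis
  have "mset vs = mset ws" using assms by (simp add: set_eq_iff_mset_eq_distinct)
  then obtain p where p: "p permutes {..<length ws}" and vs: "permute_list p ws = vs"
    by (rule mset_eq_permutation)
  have p': "p permutes {0..<n}" using p by (simp add: n_def atLeast0LessThan)
  have lt: "p i < n" if "i < n" for i using permutes_in_image[OF p', of i] that by auto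
  have nth: "vs ! i = ws ! p i" if "i < n" for i
    using permute_list_nth[OF p] that by (simp add: vs[symmetric] n_def)
  have inj: "p i = p j \<longleftrightarrow> i = j" for i j using permutes_inj[OF p'] by (simp add: inj_eq)
  let ?C = "char_poly_matrix (mat_of_list ws m)"
  have C: "?C \<in> carrier_mat n n"
    unfolding char_poly_matrix_def mat_of_list_def n_def by auto
  have "char_poly_matrix (mat_of_list vs m) = mat n n (\<lambda>(i, j). ?C $$ (p i, p j))"
    by (rule eq_matI)
      (auto simp: char_poly_matrix_def mat_of_list_def len n_def[symmetric] lt nth inj)
  then show ?thesis
    unfolding char_poly_def using det_permute_both[OF C p'] by simp
qed


lemma char_two:
  assumes "CARD('f :: field) = 2 ^ n"
  shows "(2 :: 'f) = 0"
proof -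
  have "of_nat CARD('f) = (0 :: 'f)"
    using CHAR_dvd_CARD of_nat_eq_0_iff_char_dvd by blast
  then show ?thesis using assms by simp
qed

lemma U_dim [simp]: "dim_row (U a b) = 3" "dim_col (U a b) = 3"
  by (simp_all add: U_def mat_of_rows_list_def)

lemma U_carrier [simp]: "U a b \<in> carrier_mat 3 3"
  by (intro carrier_matI U_dim)

lemma U_entries [simp]:
  "U a b $$ (0, 0) = 1" "U a b $$ (0, 1) = 0" "U a b $$ (0, 2) = 0"
  "U a b $$ (1, 0) = a" "U a b $$ (1, 1) = 1" "U a b $$ (1, 2) = 0"
  "U a b $$ (2, 0) = b" "U a b $$ (2, 1) = frobenius a" "U a b $$ (2, 2) = 1"
  by (simp_all add: U_def mat_of_rows_list_def)

lemma less_3_cases: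
  assumes "(i :: nat) < 3"
  obtains "i = 0" | "i = 1" | "i = 2"
proof -
  have "i = 0 \<or> i = 1 \<or> i = 2" using assms by arith
  then show thesis using that by blast
qed

lemma U_eq_iff [simp]: "U a b = U a' b' \<longleftrightarrow> a = a' \<and> b = b'"
proof
  assume eq: "U a b = U a' b'"
  have "a = U a b $$ (1, 0)" "b = U a b $$ (2, 0)" by (simp_all only: U_entries)
  then show "a = a' \<and> b = b'" unfolding eq by (simp only: U_entries)
qed simp

lemma U_0: "U 0 0 = 1\<^sub>m 3"
proof (rule eq_matI)
  fix i j
  assume "i < dim_row (1\<^sub>m 3 :: 'a mat)" "j < dim_col (1\<^sub>m 3 :: 'a mat)"
  then have "i < 3" "j < 3" by simp_all
  then show "U 0 0 $$ (i, j) = (1\<^sub>m 3 :: 'a mat) $$ (i, j)"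
    by (elim less_3_cases; simp only: U_entries; simp add: frobenius_def)
qed simp_all

lemma U_mult:
  fixes a b a' b' :: "'f :: field"
  assumes "(2 :: 'f) = 0"
  shows "U a b * U a' b' = U (a + a') (b + b' + a' * frobenius a)"
proof (rule eq_matI)
  have fr: "frobenius (a + a') = frobenius a + frobenius a'"
    unfolding frobenius_def power2_sum by (simp only: assms mult_zero_left add_0_right)
  fix i j
  assume "i < dim_row (U (a + a') (b + b' + a' * frobenius a))"
    and "j < dim_col (U (a + a') (b + b' + a' * frobenius a))"
  then have ij: "i < 3" "j < 3" by simp_all
  have "{0..<3 :: nat} = {0, 1, 2}" by auto
  then have entry: "(U a b * U a' b') $$ (i, j) =
      U a b $$ (i, 0) * U a' b' $$ (0, j) + U a b $$ (i, 1) * U a' b' $$ (1, j)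
      + U a b $$ (i, 2) * U a' b' $$ (2, j)"
    using ij by (simp add: scalar_prod_def add.assoc)
  show "(U a b * U a' b') $$ (i, j) = U (a + a') (b + b' + a' * frobenius a) $$ (i, j)"
    unfolding entry using ij
    by (elim less_3_cases; simp only: U_entries fr; simp)
qed simp_all

lemma group_U_group:
  assumes "CARD('f :: field) = 2 ^ n"
  shows "group (U_group TYPE('f))"
proof (rule groupI)
  note mult = U_mult[OF char_two[OF assms]]
  show "\<And>x y. x \<in> carrier (U_group TYPE('f)) \<Longrightarrow> y \<in> carrier (U_group TYPE('f)) \<Longrightarrow>
      x \<otimes>\<^bsub>U_group TYPE('f)\<^esub> y \<in> carrier (U_group TYPE('f))"
    by (auto simp: U_group_def mult)
  show "\<one>\<^bsub>U_group TYPE('f)\<^esub> \<in> carrier (U_group TYPE('f))"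
    using U_0 by (auto simp: U_group_def intro: sym)
  show "\<And>x y z. x \<in> carrier (U_group TYPE('f)) \<Longrightarrow> y \<in> carrier (U_group TYPE('f)) \<Longrightarrow>
      z \<in> carrier (U_group TYPE('f)) \<Longrightarrow>
      x \<otimes>\<^bsub>U_group TYPE('f)\<^esub> y \<otimes>\<^bsub>U_group TYPE('f)\<^esub> z =
      x \<otimes>\<^bsub>U_group TYPE('f)\<^esub> (y \<otimes>\<^bsub>U_group TYPE('f)\<^esub> z)"
    by (auto simp: U_group_def intro!: assoc_mult_mat[of _ 3 3 _ 3 _ 3])
  show "\<And>x. x \<in> carrier (U_group TYPE('f)) \<Longrightarrow>
      \<one>\<^bsub>U_group TYPE('f)\<^esub> \<otimes>\<^bsub>U_group TYPE('f)\<^esub> x = x"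
    by (auto simp: U_group_def intro!: left_mult_one_mat[of _ 3 3])
  fix x assume "x \<in> carrier (U_group TYPE('f))"
  then obtain a b :: 'f where x: "x = U a b" by (auto simp: U_group_def)
  have "U (- a) (- b - a * frobenius (- a)) * U a b = 1\<^sub>m 3"
    by (simp add: mult U_0[symmetric])
  then show "\<exists>y\<in>carrier (U_group TYPE('f)).
      y \<otimes>\<^bsub>U_group TYPE('f)\<^esub> x = \<one>\<^bsub>U_group TYPE('f)\<^esub>"
    unfolding x by (auto simp: U_group_def)
qed

lemma U_group_not_commutative:
  assumes card: "CARD('f :: field) = 2 ^ n" and n: "n \<ge> 2"
  shows "\<not> comm_group (U_group TYPE('f))"
proof
  assume "comm_group (U_group TYPE('f))"
  then interpret comm_group "U_group TYPE('f)" .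
  note mult = U_mult[OF char_two[OF card]]
  have "\<exists>c :: 'f. c \<notin> {0, 1}"
  proof (rule ccontr)
    assume "\<nexists>c :: 'f. c \<notin> {0, 1}"
    then have "(UNIV :: 'f set) \<subseteq> {0, 1}" by auto
    then have "CARD('f) \<le> card {0 :: 'f, 1}" by (intro card_mono) auto
    moreover have "(2 :: nat) ^ 2 \<le> 2 ^ n" using n by (rule power_increasing) simp
    ultimately show False using card by simp
  qed
  then obtain c :: 'f where c: "c \<noteq> 0" "c \<noteq> 1" by auto
  have "U c 0 * U 1 0 = U 1 0 * U c 0"
    using m_comm[of "U c 0" "U 1 0"] by (auto simp: U_group_def)
  then have "c * c = c" by (simp add: mult frobenius_def power2_eq_square)
  then show False using c by simp
qed

end

theory Submission
  imports Defs "Jordan_Normal_Form.Schur_Decomposition"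
begin

text \<open>Two non-central elements \<open>U a b\<close> and \<open>U a' b'\<close> commute iff \<open>a = a'\<close>, so with \<open>q = 2 ^ n\<close>
  the commuting graph is a disjoint union of \<open>q - 1\<close> cliques of size \<open>q\<close>. If \<open>J\<close> is the matrix of
  the relation ``in the same clique'', then the three matrices of the graph all have the form
  \<open>M = c 1 + d J\<close>. From \<open>J\<^sup>2 = q J\<close> the only possible eigenvalues of \<open>M\<close> are \<open>c\<close> and \<open>c + d q\<close>,
  and the trace of \<open>M\<close> determines their multiplicities.\<close>

section \<open>Spectrum of a matrix with a quadratic equation and known trace\<close>

lemma trace_mult_comm:
  fixes A B :: "'a :: comm_semiring_0 mat"
  assumes "A \<in> carrier_mat n m" "B \<in> carrier_mat m n"
  shows "(\<Sum>i<n. (A * B) $$ (i, i)) = (\<Sum>i<m. (B * A) $$ (i, i))"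
proof -
  have "(\<Sum>i<n. (A * B) $$ (i, i)) = (\<Sum>i<n. \<Sum>j<m. A $$ (i, j) * B $$ (j, i))"
    using assms by (intro sum.cong) (auto simp: scalar_prod_def atLeast0LessThan)
  also have "\<dots> = (\<Sum>j<m. \<Sum>i<n. B $$ (j, i) * A $$ (i, j))"
    by (subst sum.swap) (simp add: mult.commute)
  also have "\<dots> = (\<Sum>j<m. (B * A) $$ (j, j))"
    using assms by (intro sum.cong) (auto simp: scalar_prod_def atLeast0LessThan)
  finally show ?thesis .
qed

text \<open>Schur triangularisation writes \<open>A\<close> as \<open>P * B * Q\<close> with
  \<open>es\<close> on the diagonal of \<open>B\<close>. Cyclicity of the trace moves
  \<open>Q\<close> to the front, where it cancels \<open>P\<close>.\<close>

lemma sum_list_char_poly_roots: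
  fixes A :: "'a :: conjugatable_ordered_field mat"
  assumes A: "A \<in> carrier_mat n n" and es: "char_poly A = (\<Prod>e\<leftarrow>es. [:- e, 1:])"
  shows "sum_list es = (\<Sum>i<n. A $$ (i, i))"
proof -
  obtain B P Q where "schur_decomposition A es = (B, P, Q)"
    by (cases "schur_decomposition A es") auto
  from schur_decomposition[OF A es this]
  have sim: "similar_mat_wit A B P Q" and diag: "diag_mat B = es" by auto
  note D = similar_mat_witD2[OF A sim]
  have "(\<Sum>i<n. A $$ (i, i)) = (\<Sum>i<n. (Q * (P * B)) $$ (i, i))"
    unfolding D(3) using D(5-7) by (intro trace_mult_comm) auto
  also have "Q * (P * B) = B"
    using D assoc_mult_mat[of Q n n P n B n] by simp
  also have "(\<Sum>i<n. B $$ (i, i)) = sum_list (diag_mat B)"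
    using D(5) by (simp add: diag_mat_def sum_list_sum_nth atLeast0LessThan)
  finally show ?thesis using diag by simp
qed

lemma proots_prod_list_linear:
  "proots (\<Prod>e\<leftarrow>es. [:- e, 1:]) = mset (es :: 'a :: idom list)"
proof (induction es)
  case (Cons e es)
  have "(\<Prod>e\<leftarrow>es. [:- e, 1:]) \<noteq> 0" by (auto simp: prod_list_zero_iff)
  then show ?case using Cons by (simp add: proots_mult del: mult_pCons_left)
qed simp

text \<open>Hypothesis \<open>sq\<close> is (A - \<alpha>)(A - \<beta>) = 0 written entrywise.
  Applying \<open>A\<close> twice to an eigenvector and reading off a nonzero coordinate gives (e -
  \<alpha>)(e - \<beta>) = 0.\<close>

lemma eigenvalue_quadratic:
  fixes A :: "'a :: field mat"
  assumes A: "A \<in> carrier_mat n n"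
    and sq: "\<And>i j. i < n \<Longrightarrow> j < n \<Longrightarrow>
      (\<Sum>k<n. A $$ (i, k) * A $$ (k, j)) = (\<alpha> + \<beta>) * A $$ (i, j) - (if i = j then \<alpha> * \<beta> else 0)"
    and ev: "eigenvalue A e"
  shows "e = \<alpha> \<or> e = \<beta>"
proof -
  obtain v where v: "v \<in> carrier_vec n" "v \<noteq> 0\<^sub>v n" and Av: "A *\<^sub>v v = e \<cdot>\<^sub>v v"
    using ev A by (auto simp: eigenvalue_def eigenvector_def)
  have row: "(\<Sum>j<n. A $$ (i, j) * v $ j) = e * v $ i" if "i < n" for i
    using arg_cong[OF Av, of "\<lambda>w. w $ i"] that A v
    by (simp add: scalar_prod_def atLeast0LessThan)
  obtain i where i: "i < n" "v $ i \<noteq> 0"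
    using v by (metis eq_vecI carrier_vecD index_zero_vec)
  have "e * (e * v $ i) = (\<Sum>k<n. A $$ (i, k) * (e * v $ k))"
    unfolding row[OF i(1), symmetric] by (simp add: sum_distrib_left mult.left_commute)
  also have "\<dots> = (\<Sum>k<n. A $$ (i, k) * (\<Sum>j<n. A $$ (k, j) * v $ j))"
    by (simp add: row)
  also have "\<dots> = (\<Sum>j<n. (\<Sum>k<n. A $$ (i, k) * A $$ (k, j)) * v $ j)"
    by (simp add: sum_distrib_left sum_distrib_right mult.assoc, rule sum.swap)
  also have "\<dots> = (\<Sum>j<n. (\<alpha> + \<beta>) * (A $$ (i, j) * v $ j) - (if i = j then \<alpha> * \<beta> * v $ j else 0))"
    using i by (intro sum.cong refl) (auto simp: sq left_diff_distrib mult.assoc)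
  also have "\<dots> = (\<alpha> + \<beta>) * (e * v $ i) - \<alpha> * \<beta> * v $ i"
    using i by (simp add: sum_subtractf sum_distrib_left[symmetric] row)
  finally have "(e - \<alpha>) * (e - \<beta>) * v $ i = 0" by (simp add: algebra_simps)
  then show ?thesis using i by simp
qed

text \<open>The unknown multiplicities \<open>x\<close> and \<open>y\<close> satisfy two linear
  equations, one from the degree of the characteristic polynomial and one from the trace. As
  \<alpha> and \<beta> differ, the solution is unique.\<close>

lemma eigenvalue_mset_quadratic:
  assumes A: "A \<in> carrier_mat (k + l) (k + l)"
    and sq: "\<And>i j. i < k + l \<Longrightarrow> j < k + l \<Longrightarrow> (\<Sum>r<k + l. A $$ (i, r) * A $$ (r, j))
        = (\<alpha> + \<beta>) * A $$ (i, j) - (if i = j then \<alpha> * \<beta> else 0)"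
    and tr: "(\<Sum>i<k + l. A $$ (i, i)) = of_nat k * \<alpha> + of_nat l * \<beta>"
    and neq: "\<alpha> \<noteq> \<beta>"
  shows "eigenvalue_mset A = replicate_mset k \<alpha> + replicate_mset l \<beta>"
proof -
  obtain es where es: "char_poly A = (\<Prod>e\<leftarrow>es. [:- e, 1:])" and len: "length es = k + l"
    using char_poly_factorized[OF A] by blast
  have mset: "eigenvalue_mset A = mset es"
    by (simp add: eigenvalue_mset_def es proots_prod_list_linear)
  have "e = \<alpha> \<or> e = \<beta>" if "e \<in> set es" for e
  proof (rule eigenvalue_quadratic[OF A sq])
    show "eigenvalue A e"
      unfolding eigenvalue_root_char_poly[OF A] es by (rule linear_poly_root[OF that])
  qed
  then have two: "\<exists>x y. mset es = replicate_mset x \<alpha> + replicate_mset y \<beta>"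
  proof (induction es)
    case (Cons e es)
    then obtain x y where "mset es = replicate_mset x \<alpha> + replicate_mset y \<beta>" by auto
    moreover have "e = \<alpha> \<or> e = \<beta>" using Cons.prems by simp
    ultimately have "mset (e # es) = replicate_mset (Suc x) \<alpha> + replicate_mset y \<beta>
        \<or> mset (e # es) = replicate_mset x \<alpha> + replicate_mset (Suc y) \<beta>" by auto
    then show ?case by blast
  qed (auto intro: exI[of _ 0])
  then obtain x y where xy: "mset es = replicate_mset x \<alpha> + replicate_mset y \<beta>" by blast
  have kl: "x + y = k + l" using len arg_cong[OF xy, of size] by simp
  have "of_nat x * \<alpha> + of_nat y * \<beta> = sum_list es"
    using arg_cong[OF xy, of sum_mset] by (simp add: sum_mset_sum_list)
  also have "\<dots> = of_nat k * \<alpha> + of_nat l * \<beta>"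
    using sum_list_char_poly_roots[OF A es] tr by simp
  finally have "of_nat x * \<alpha> + of_nat y * \<beta> = of_nat k * \<alpha> + of_nat l * \<beta>" .
  moreover have "(of_nat y :: complex) = of_nat k + of_nat l - of_nat x"
    using arg_cong[OF kl, of "of_nat :: nat \<Rightarrow> complex"] by (simp add: algebra_simps)
  ultimately have "(of_nat x - of_nat k) * (\<alpha> - \<beta>) = 0" by (simp add: algebra_simps)
  then have "x = k" using neq by simp
  then show ?thesis using kl mset xy by simp
qed

section \<open>Disjoint unions of cliques of equal size\<close>

text \<open>The fibres of \<open>f\<close> on the vertices are the cliques: there are
  \<open>k\<close> of them, each of size \<open>q\<close>.\<close>

locale equal_cliques =
  fixes g :: "'v ugraph" and f :: "'v \<Rightarrow> 'c" and q k :: nat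
  assumes finite_verts: "finite (verts g)"
    and edges_eq: "edges g = {{x, y} | x y. x \<in> verts g \<and> y \<in> verts g \<and> x \<noteq> y \<and> f x = f y}"
    and card_fibre: "\<And>v. v \<in> verts g \<Longrightarrow> card {w \<in> verts g. f w = f v} = q"
    and card_verts: "card (verts g) = k * q"
    and pos: "q > 0" "k > 0"
begin

text \<open>This is c I + d J, where J is the relation of lying in the same clique. J contains the
  diagonal, so the diagonal entries are \<open>c + d\<close>.\<close>

abbreviation "block_mat c d \<equiv>
  mat_of_list (vertex_list g) (\<lambda>u v. (if u = v then c else 0) + (if f u = f v then d else 0))"

lemma edge_iff: "{u, v} \<in> edges g \<longleftrightarrow> u \<in> verts g \<and> v \<in> verts g \<and> u \<noteq> v \<and> f u = f v"
  by (auto simp: edges_eq doubleton_eq_iff)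

lemma degree: "degree_of g v = q - 1" if v: "v \<in> verts g"
proof -
  \<comment> \<open>An edge at \<open>v\<close> is determined by its other end, which ranges over
    the rest of the fibre.\<close>
  have "{e \<in> edges g. v \<in> e} = (\<lambda>w. {v, w}) ` ({w \<in> verts g. f w = f v} - {v})"
    using v unfolding edges_eq by (auto simp: image_iff)
  moreover have "inj_on (\<lambda>w. {v, w}) A" for A :: "'v set"
    by (auto simp: inj_on_def doubleton_eq_iff)
  ultimately show ?thesis
    using v finite_verts by (simp add: degree_of_def card_image card_Diff_singleton card_fibre)
qed

text \<open>Incident pairs of vertex and edge are counted twice: each edge has two ends, and each of
  the k q vertices has degree q - 1.\<close>

lemma mean_degree: "mean_degree g = real q - 1"
proof -
  have fin: "finite (edges g)"
    using finite_verts by (rule finite_subset[rotated, OF finite_Pow_iff[THEN iffD2]])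
      (auto simp: edges_eq)
  have "card {v \<in> verts g. v \<in> e} = 2" if e: "e \<in> edges g" for e
  proof -
    obtain x y where "e = {x, y}" "x \<noteq> y" "x \<in> verts g" "y \<in> verts g"
      using e unfolding edges_eq by blast
    then have "{v \<in> verts g. v \<in> e} = {x, y}" "x \<noteq> y" by auto
    then show ?thesis by simp
  qed
  then have "(\<Sum>v\<in>verts g. degree_of g v) = 2 * card (edges g)"
    unfolding degree_of_def using finite_verts fin by (intro sum_multicount) auto
  then have "2 * card (edges g) = k * q * (q - 1)" by (simp add: degree card_verts)
  from arg_cong[OF this, of real] have "2 * real (card (edges g)) = real k * real q * (real q - 1)"
    using pos by (simp add: of_nat_diff)
  then show ?thesis using pos by (simp add: mean_degree_def card_verts)
qed

text \<open>From J^2 = q J, the matrix M = c I + d J satisfies (M - c)(M - c - d q) = 0. Its trace k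
  q (c + d) equals k (q - 1) c + k (c + d q), which yields the multiplicities.\<close>

lemma eigenvalue_mset_block_mat:
  assumes d: "d \<noteq> 0"
  shows "eigenvalue_mset (block_mat c d)
    = replicate_mset (k * (q - 1)) c + replicate_mset k (c + d * of_nat q)"
proof -
  note vl = vertex_list[OF finite_verts]
  \<comment> \<open>The size k q is written as the sum of the two multiplicities, the shape that
    \<open>eigenvalue_mset_quadratic\<close> expects.\<close>
  let ?vs = "vertex_list g" and ?N = "k * (q - 1) + k"
  let ?m = "\<lambda>u v. (if u = v then c else 0) + (if f u = f v then d else (0 :: complex))"
  have N: "?N = k * q" using pos by (cases q) auto
  have len: "length ?vs = ?N"
    using vl distinct_card card_verts unfolding N by metis
  have sum_vl: "(\<Sum>r<?N. h (?vs ! r)) = (\<Sum>v\<in>verts g. h v)" for h :: "'v \<Rightarrow> complex"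
  proof -
    have "(\<Sum>v\<in>verts g. h v) = sum_list (map h ?vs)"
      using vl by (metis sum_list_distinct_conv_sum_set)
    then show ?thesis by (simp add: sum_list_sum_nth len atLeast0LessThan)
  qed
  have fibre: "(\<Sum>v\<in>verts g. if f v = f w then h else 0) = h * of_nat q" if "w \<in> verts g"
    for w and h :: complex
    using finite_verts card_fibre[OF that] by (simp add: sum.If_cases Int_def)
  have sq: "(\<Sum>v\<in>verts g. ?m u v * ?m v w)
      = (c + (c + d * of_nat q)) * ?m u w - (if u = w then c * (c + d * of_nat q) else 0)"
    if uw: "u \<in> verts g" "w \<in> verts g" for u w
  proof -
    \<comment> \<open>The summand splits into c I times M, d J times c I, and d J times d J. In the
      last, f u = f v = f w is restated as a condition on \<open>v\<close> and \<open>w\<close> and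
      one on \<open>u\<close> and \<open>w\<close>, so that the sum over a fibre gives the factor
      \<open>q\<close>.\<close>
    have "(\<Sum>v\<in>verts g. ?m u v * ?m v w) = (\<Sum>v\<in>verts g. (if u = v then c * ?m u w else 0)
        + (if v = w then (if f u = f w then d * c else 0) else 0)
        + (if f v = f w then (if f u = f w then d * d else 0) else 0))"
      by (intro sum.cong) (auto simp: algebra_simps)
    also have "\<dots> = c * ?m u w + (if f u = f w then d * c else 0)
        + (if f u = f w then d * d else 0) * of_nat q"
      using uw finite_verts by (simp add: sum.distrib fibre)
    finally show ?thesis by (auto simp: algebra_simps)
  qed
  have entry: "block_mat c d $$ (i, j) = ?m (?vs ! i) (?vs ! j)" if "i < ?N" "j < ?N" for i j
    using that by (simp add: mat_of_list_def len)
  have in_verts: "?vs ! i \<in> verts g" if "i < ?N" for i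
    using that vl(2) len nth_mem by metis
  show ?thesis
  proof (rule eigenvalue_mset_quadratic)
    show "block_mat c d \<in> carrier_mat ?N ?N" by (simp add: mat_of_list_def len)
    show "c \<noteq> c + d * of_nat q" using d pos by simp
    have "(\<Sum>i<?N. block_mat c d $$ (i, i)) = of_nat ?N * (c + d)"
      by (simp add: entry)
    also have "\<dots> = of_nat (k * (q - 1)) * c + of_nat k * (c + d * of_nat q)"
      unfolding N using pos by (simp add: of_nat_diff algebra_simps)
    finally show "(\<Sum>i<?N. block_mat c d $$ (i, i))
      = of_nat (k * (q - 1)) * c + of_nat k * (c + d * of_nat q)" .
  next
    fix i j assume ij: "i < ?N" "j < ?N"
    have "(\<Sum>r<?N. block_mat c d $$ (i, r) * block_mat c d $$ (r, j))
        = (\<Sum>v\<in>verts g. ?m (?vs ! i) v * ?m v (?vs ! j))"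
      unfolding sum_vl[symmetric] using ij by (intro sum.cong) (simp_all add: entry)
    moreover have "?vs ! i = ?vs ! j \<longleftrightarrow> i = j"
      using ij vl(1) len by (simp add: nth_eq_iff_index_eq)
    ultimately show "(\<Sum>r<?N. block_mat c d $$ (i, r) * block_mat c d $$ (r, j))
        = (c + (c + d * of_nat q)) * block_mat c d $$ (i, j)
          - (if i = j then c * (c + d * of_nat q) else 0)"
      using sq[OF in_verts[OF ij(1)] in_verts[OF ij(2)]] entry[OF ij] by simp
  qed
qed

text \<open>Removing the loops from J gives A = J - I, and regularity gives D = (q - 1) I.\<close>

lemma matrices_eq_block_mat:
  shows "adjacency_mat g = block_mat (- 1) 1"
    and "laplacian_mat g = block_mat (of_nat q) (- 1)"
    and "signless_laplacian_mat g = block_mat (of_nat q - 2) 1"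
proof -
  note vl = vertex_list[OF finite_verts]
  have in_verts: "vertex_list g ! i \<in> verts g" if "i < length (vertex_list g)" for i
    using that vl(2) nth_mem by metis
  show A: "adjacency_mat g = block_mat (- 1) 1"
    by (rule eq_matI) (auto simp: adjacency_mat_def mat_of_list_def edge_iff in_verts)
  show "laplacian_mat g = block_mat (of_nat q) (- 1)"
    unfolding laplacian_mat_def A degree_mat_def using pos
    by (intro eq_matI) (auto simp: mat_of_list_def degree in_verts of_nat_diff)
  show "signless_laplacian_mat g = block_mat (of_nat q - 2) 1"
    unfolding signless_laplacian_mat_def A degree_mat_def using pos
    by (intro eq_matI) (auto simp: mat_of_list_def degree in_verts of_nat_diff)
qed

text \<open>The graph is regular of degree q - 1, its mean degree, so the shifted matrices of L and
  Q are -A and A. Each energy therefore sums k (q - 1) terms 1 and k terms q - 1.\<close>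

lemma energies:
  shows "energy g = 2 * real k * (real q - 1)"
    and "laplacian_energy g = 2 * real k * (real q - 1)"
    and "signless_laplacian_energy g = 2 * real k * (real q - 1)"
proof -
  have norm: "cmod (of_nat q - 1) = real q - 1"
  proof -
    have "of_nat q - 1 = complex_of_real (real q - 1)" by simp
    then show ?thesis using pos by (simp only: norm_of_real)
  qed
  \<comment> \<open>The Laplacian eigenvalue q - q = 0 is shifted to 1 - q.\<close>
  have norm': "cmod (1 - of_nat q) = real q - 1"
    using norm by (simp add: norm_minus_commute)
  show "energy g = 2 * real k * (real q - 1)"
    unfolding energy_def matrices_eq_block_mat
    by (subst eigenvalue_mset_block_mat) (use pos in \<open>simp_all add: norm of_nat_diff\<close>)
  show "laplacian_energy g = 2 * real k * (real q - 1)"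
    unfolding laplacian_energy_def matrices_eq_block_mat mean_degree
    by (subst eigenvalue_mset_block_mat) (use pos in \<open>simp_all add: norm norm' of_nat_diff\<close>)
  show "signless_laplacian_energy g = 2 * real k * (real q - 1)"
    unfolding signless_laplacian_energy_def matrices_eq_block_mat mean_degree
    by (subst eigenvalue_mset_block_mat) (use pos in \<open>simp_all add: norm norm' of_nat_diff\<close>)
qed

end

section \<open>The commuting graph of the matrix group\<close>

text \<open>The two products differ at most in the corner entry, by a' a^2 against a a'^2, up to
  sign a a' (a - a').\<close>

lemma U_commute_iff:
  fixes a b a' b' :: "'f :: field"
  assumes "(2 :: 'f) = 0"
  shows "U a b * U a' b' = U a' b' * U a b \<longleftrightarrow> a = 0 \<or> a' = 0 \<or> a = a'"
proof -
  have "U a b * U a' b' = U a' b' * U a b \<longleftrightarrow> a * a' * (a - a') = 0"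
    by (auto simp: U_mult[OF assms] frobenius_def power2_eq_square algebra_simps)
  then show ?thesis by simp
qed

lemma U_group_noncentral:
  assumes card: "CARD('f :: field) = 2 ^ n" and n: "n \<ge> 2"
  shows "carrier (U_group TYPE('f)) - group_center (U_group TYPE('f))
    = (\<lambda>(a, b). U a b) ` ((UNIV - {0 :: 'f}) \<times> UNIV)"
proof -
  \<comment> \<open>For nonzero \<open>a\<close> such a \<open>c\<close> gives an element
    \<open>U c b'\<close> not commuting with \<open>U a b\<close>. It exists because the field has
    at least four elements.\<close>
  have "\<exists>c :: 'f. c \<noteq> 0 \<and> c \<noteq> a" for a
  proof (rule ccontr)
    assume "\<not> (\<exists>c :: 'f. c \<noteq> 0 \<and> c \<noteq> a)"
    then have "(UNIV :: 'f set) \<subseteq> {0, a}" by auto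
    then have "CARD('f) \<le> card {0 :: 'f, a}" by (intro card_mono) auto
    also have "\<dots> \<le> 2" by (simp add: card_insert_if)
    also have "\<dots> < (2 :: nat) ^ 2" by simp
    also have "\<dots> \<le> 2 ^ n" using n by (rule power_increasing) simp
    finally show False using card by simp
  qed
  then have "(\<forall>a' :: 'f. a = 0 \<or> a' = 0 \<or> a = a') \<longleftrightarrow> a = 0" for a
    by metis
  moreover have "U a b \<in> group_center (U_group TYPE('f))
      \<longleftrightarrow> (\<forall>a' b' :: 'f. U a b * U a' b' = U a' b' * U a b)" for a b :: 'f
    unfolding group_center_def U_group_def by fastforce
  ultimately have "U a b \<in> group_center (U_group TYPE('f)) \<longleftrightarrow> a = 0" for a b :: 'f
    by (simp add: U_commute_iff[OF char_two[OF card]])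
  then show ?thesis by (auto simp: U_group_def image_iff)
qed

text \<open>The entry at \<open>(1, 0)\<close> of \<open>U a b\<close> is \<open>a\<close>. The
  vertices have \<open>a\<close> nonzero, so commuting there means equal \<open>a\<close>: 2^n - 1
  labels, with 2^n choices of \<open>b\<close> for each.\<close>

lemma equal_cliques_commuting_graph:
  assumes card: "CARD('f :: field) = 2 ^ n" and n: "n \<ge> 2"
  shows "equal_cliques (commuting_graph (U_group TYPE('f))) (\<lambda>M. M $$ (1, 0)) (2 ^ n) (2 ^ n - 1)"
proof
  let ?G = "commuting_graph (U_group TYPE('f))"
  have verts: "verts ?G = (\<lambda>(a, b). U a b) ` ((UNIV - {0 :: 'f}) \<times> UNIV)"
    using U_group_noncentral[OF card n] by (simp add: commuting_graph_def)
  have fin: "finite (UNIV :: 'f set)" using card by (intro card_ge_0_finite) simp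
  have inj: "inj_on (\<lambda>(a, b). U a b) A" for A :: "('f \<times> 'f) set"
    by (auto simp: inj_on_def)
  show "finite (verts ?G)" using fin by (simp add: verts finite_cartesian_product)
  have "x \<otimes>\<^bsub>U_group TYPE('f)\<^esub> y = y \<otimes>\<^bsub>U_group TYPE('f)\<^esub> x \<longleftrightarrow> x $$ (1, 0) = y $$ (1, 0)"
    if "x \<in> verts ?G" "y \<in> verts ?G" for x y
    using that unfolding verts
    by (auto simp: U_group_def U_commute_iff[OF char_two[OF card]] simp del: One_nat_def)
  then show "edges ?G = {{x, y} | x y. x \<in> verts ?G \<and> y \<in> verts ?G \<and> x \<noteq> y
      \<and> x $$ (1, 0) = y $$ (1, 0)}"
    by (simp add: commuting_graph_def del: One_nat_def) blast
  show "card {w \<in> verts ?G. w $$ (1, 0) = v $$ (1, 0)} = 2 ^ n" if vG: "v \<in> verts ?G" for v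
  proof -
    obtain a b where v: "v = U a b" "a \<noteq> 0" using vG by (auto simp: verts)
    have "{w \<in> verts ?G. w $$ (1, 0) = v $$ (1, 0)} = (\<lambda>(a, b). U a b) ` ({a} \<times> UNIV)"
      using v by (auto simp: verts simp del: One_nat_def)
    then show ?thesis using card fin by (simp add: card_image[OF inj] card_cartesian_product)
  qed
  show "card (verts ?G) = (2 ^ n - 1) * 2 ^ n"
    using card fin by (simp add: verts card_image[OF inj] card_cartesian_product card_Diff_singleton)
  show "(0 :: nat) < 2 ^ n" "(0 :: nat) < 2 ^ n - 1"
    using n one_less_power[of "2 :: nat" n] by auto
qed

theorem proposition2p12:
  fixes n :: nat
  assumes "CARD('f :: field) = 2 ^ n" and "n \<ge> 2"
  shows "energy (commuting_graph (U_group TYPE('f)))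
           = laplacian_energy (commuting_graph (U_group TYPE('f)))
       \<and> laplacian_energy (commuting_graph (U_group TYPE('f)))
           = signless_laplacian_energy (commuting_graph (U_group TYPE('f)))
       \<and> signless_laplacian_energy (commuting_graph (U_group TYPE('f))) = 2 * (2 ^ n - 1) ^ 2"
proof -
  \<comment> \<open>Here k = q - 1, so 2 k (q - 1) becomes the square in the claim.\<close>
  interpret equal_cliques "commuting_graph (U_group TYPE('f))" "\<lambda>M. M $$ (1, 0)" "2 ^ n" "2 ^ n - 1"
    by (rule equal_cliques_commuting_graph[OF assms])
  show ?thesis by (simp add: energies of_nat_diff power2_eq_square)
qed

end
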